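(* Suppose that $V(r,z)=\|z-r\|^2/2$ for any $r,z\in Z$, where $\|\cdot\|$ is the norm induced by the inner product (so that $\mu=1$), and let $u^*$ be a strong solution of $VI(Z;G,H,J)$. Suppose the parameters $\{\alpha_t\}_{t\ge1}$ and $\{\gamma_t\}_{t\ge1}$ (with $\gamma_t>0$) in the AMP method are chosen such that $\alpha_1=1$, $0\le\alpha_t<1$ for all $t>1$, and, for some constant $c\in[0,1)$ and all $t\ge1$, $$L_G\alpha_t\gamma_t+L_H^2\gamma_t^2\le c^2\qquad\text{and}\qquad\frac{\alpha_t}{\Gamma_t\gamma_t}=\frac{\alpha_{t+1}}{\Gamma_{t+1}\gamma_{t+1}},$$ where $\Gamma_1=1$ and $\Gamma_t=(1-\alpha_t)\Gamma_{t-1}$ for $t>1$. Then for all $t\ge1$ there exist $v_{t+1}\in\mathcal E$ and $\varepsilon_{t+1}\ge0$ such that $\tilde g(w^{ag}_{t+1},v_{t+1})\le\varepsilon_{t+1}$, and moreover $$\|v_{t+1}\|\le\frac{2\alpha_tD}{\gamma_t}\qquad\text{and}\qquad\varepsilon_{t+1}\le\frac{3\alpha_t(1+\theta_t)D^2}{\gamma_t},$$ where $$D:=\|r_1-u^*\|,\qquad\theta_t:=\frac{\Gamma_t}{2(1-c^2)}\max_{i=1,\ldots,t}\frac{\alpha_i}{\Gamma_i}.$$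
   Context: Setting. $\mathcal E$ is a finite-dimensional real vector space with inner product $\langle\cdot,\cdot\rangle$ and induced norm $\|\cdot\|$; $Z\subset\mathcal E$ is a nonempty closed convex set (possibly unbounded). $G$ is continuously differentiable with $0\le G(w)-G(v)-\langle\nabla G(v),w-v\rangle\le\frac{L_G}{2}\|w-v\|^2$ for all $w,v\in Z$. $H:Z\to\mathcal E$ satisfies $\langle H(w)-H(v),w-v\rangle\ge0$ and $\|H(w)-H(v)\|\le L_H\|w-v\|$ for all $w,v\in Z$. $J$ is a real-valued convex function on $Z$ having a subgradient $J'(u)\in\partial J(u)$ at each $u\in Z$. $VI(Z;G,H,J)$ is the variational inequality with operator $F(u)=\nabla G(u)+H(u)+J'(u)$; a strong solution is a point $u^*\in Z$ with $\langle F(u^* ),u^*-u\rangle\le0$ for all $u\in Z$. Prox-mapping. For $z\in Z$, $\eta\in\mathcal E$, $\gamma>0$, $P_z^{\gamma J}(\eta)=\operatorname{argmin}_{u\in Z}\{\langle\eta,u-z\rangle+V(z,u)+\gamma J(u)\}$, assumed to be well defined. AMP method. Choose $r_1\in Z$ and set $w_1=w_1^{ag}=r_1$. For $t=1,2,\ldots$: $w_t^{md}=(1-\alpha_t)w_t^{ag}+\alpha_tr_t$; $w_{t+1}=P_{r_t}^{\gamma_tJ}(\gamma_tH(r_t)+\gamma_t\nabla G(w_t^{md}))$; $r_{t+1}=P_{r_t}^{\gamma_tJ}(\gamma_tH(w_{t+1})+\gamma_t\nabla G(w_t^{md}))$; $w_{t+1}^{ag}=(1-\alpha_t)w_t^{ag}+\alpha_tw_{t+1}$.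 Gap function. $Q(\tilde u,u)=G(\tilde u)-G(u)+\langle H(u),\tilde u-u\rangle+J(\tilde u)-J(u)$ for $\tilde u,u\in Z$, and $\tilde g(\tilde u,\tilde v)=\sup_{u\in Z}\{Q(\tilde u,u)-\langle\tilde v,\tilde u-u\rangle\}$ for $\tilde u\in Z$, $\tilde v\in\mathcal E$. *)

theory Defs
  imports "HOL-Analysis.Analysis"
begin

text \<open>
  Functions on the feasible set are total functions of which only the values on \<open>Z\<close> matter.
  The sequences of the AMP method are indexed from 1; their values at 0 are irrelevant.
\<close>

text \<open>Differentiability is taken relative to \<open>Z\<close>. If \<open>Z\<close> has empty interior this does not determine
  the gradient, so the gradient map is an explicit argument.\<close>

definition continuously_differentiable_on ::
    "'a::euclidean_space set \<Rightarrow> ('a \<Rightarrow> real) \<Rightarrow> ('a \<Rightarrow> 'a) \<Rightarrow> bool" where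
  "continuously_differentiable_on Z G gradG \<longleftrightarrow>
     (\<forall>v\<in>Z. (G has_derivative (\<lambda>h. gradG v \<bullet> h)) (at v within Z)) \<and> continuous_on Z gradG"

definition subdifferential :: "'a::euclidean_space set \<Rightarrow> ('a \<Rightarrow> real) \<Rightarrow> 'a \<Rightarrow> 'a set" where
  "subdifferential Z J u = {g. \<forall>w\<in>Z. J w \<ge> J u + g \<bullet> (w - u)}"

definition strong_solution :: "'a::euclidean_space set \<Rightarrow> ('a \<Rightarrow> 'a) \<Rightarrow> 'a \<Rightarrow> bool" where
  "strong_solution Z F us \<longleftrightarrow> us \<in> Z \<and> (\<forall>u\<in>Z. F us \<bullet> (us - u) \<le> 0)"

definition prox_objective ::
    "('a::euclidean_space \<Rightarrow> 'a \<Rightarrow> real) \<Rightarrow> ('a \<Rightarrow> real) \<Rightarrow> real \<Rightarrow> 'a \<Rightarrow> 'a \<Rightarrow> 'a \<Rightarrow> real" where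
  "prox_objective V J \<gamma> z \<eta> u = \<eta> \<bullet> (u - z) + V z u + \<gamma> * J u"

definition prox ::
    "'a::euclidean_space set \<Rightarrow> ('a \<Rightarrow> 'a \<Rightarrow> real) \<Rightarrow> ('a \<Rightarrow> real) \<Rightarrow> real \<Rightarrow> 'a \<Rightarrow> 'a \<Rightarrow> 'a" where
  "prox Z V J \<gamma> z \<eta> = arg_min_on (prox_objective V J \<gamma> z \<eta>) Z"

definition prox_well_defined ::
    "'a::euclidean_space set \<Rightarrow> ('a \<Rightarrow> 'a \<Rightarrow> real) \<Rightarrow> ('a \<Rightarrow> real) \<Rightarrow> bool" where
  "prox_well_defined Z V J \<longleftrightarrow>
     (\<forall>z\<in>Z. \<forall>\<eta>. \<forall>\<gamma>>0. \<exists>!u. is_arg_min (prox_objective V J \<gamma> z \<eta>) (\<lambda>u. u \<in> Z) u)"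

definition AMP ::
    "'a::euclidean_space set \<Rightarrow> ('a \<Rightarrow> 'a \<Rightarrow> real) \<Rightarrow> ('a \<Rightarrow> 'a) \<Rightarrow> ('a \<Rightarrow> 'a) \<Rightarrow> ('a \<Rightarrow> real) \<Rightarrow>
     (nat \<Rightarrow> real) \<Rightarrow> (nat \<Rightarrow> real) \<Rightarrow>
     (nat \<Rightarrow> 'a) \<Rightarrow> (nat \<Rightarrow> 'a) \<Rightarrow> (nat \<Rightarrow> 'a) \<Rightarrow> (nat \<Rightarrow> 'a) \<Rightarrow> bool" where
  "AMP Z V gradG H J \<alpha> \<gamma> r w w_ag w_md \<longleftrightarrow>
     r 1 \<in> Z \<and> w 1 = r 1 \<and> w_ag 1 = r 1 \<and>
     (\<forall>t\<ge>1.
        w_md t = (1 - \<alpha> t) *\<^sub>R w_ag t + \<alpha> t *\<^sub>R r t \<and>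
        w (t + 1) = prox Z V J (\<gamma> t) (r t) (\<gamma> t *\<^sub>R H (r t) + \<gamma> t *\<^sub>R gradG (w_md t)) \<and>
        r (t + 1) = prox Z V J (\<gamma> t) (r t) (\<gamma> t *\<^sub>R H (w (t + 1)) + \<gamma> t *\<^sub>R gradG (w_md t)) \<and>
        w_ag (t + 1) = (1 - \<alpha> t) *\<^sub>R w_ag t + \<alpha> t *\<^sub>R w (t + 1))"

definition Q_gap ::
    "('a::euclidean_space \<Rightarrow> real) \<Rightarrow> ('a \<Rightarrow> 'a) \<Rightarrow> ('a \<Rightarrow> real) \<Rightarrow> 'a \<Rightarrow> 'a \<Rightarrow> real" where
  "Q_gap G H J ut u = G ut - G u + H u \<bullet> (ut - u) + J ut - J u"

text \<open>Since \<open>Z\<close> may be unbounded, the supremum may be infinite; hence the type \<open>ereal\<close>.\<close>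

definition perturbed_gap ::
    "'a::euclidean_space set \<Rightarrow> ('a \<Rightarrow> real) \<Rightarrow> ('a \<Rightarrow> 'a) \<Rightarrow> ('a \<Rightarrow> real) \<Rightarrow> 'a \<Rightarrow> 'a \<Rightarrow> ereal" where
  "perturbed_gap Z G H J ut vt = (SUP u\<in>Z. ereal (Q_gap G H J ut u - vt \<bullet> (ut - u)))"

text \<open>\<open>\<Gamma>\<^sub>1 = 1\<close> and \<open>\<Gamma>\<^sub>t = (1 - \<alpha>\<^sub>t) \<Gamma>\<^sub>t\<^sub>-\<^sub>1\<close> for \<open>t > 1\<close>; the value at 0 is a dummy.\<close>

primrec Gam :: "(nat \<Rightarrow> real) \<Rightarrow> nat \<Rightarrow> real" where
  "Gam \<alpha> 0 = 1"
| "Gam \<alpha> (Suc n) = (if n = 0 then 1 else (1 - \<alpha> (Suc n)) * Gam \<alpha> n)"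

definition theta :: "(nat \<Rightarrow> real) \<Rightarrow> real \<Rightarrow> nat \<Rightarrow> real" where
  "theta \<alpha> c t = Gam \<alpha> t / (2 * (1 - c\<^sup>2)) * Max ((\<lambda>i. \<alpha> i / Gam \<alpha> i) ` {1..t})"

end

theory Submission
  imports Defs
begin

text \<open>
  For every \<open>u \<in> Z\<close> one AMP step gives
  \<open>Q(w\<^sup>a\<^sup>g\<^sub>t\<^sub>+\<^sub>1, u) \<le> (1 - \<alpha>\<^sub>t) Q(w\<^sup>a\<^sup>g\<^sub>t, u)
    + \<alpha>\<^sub>t/(2\<gamma>\<^sub>t) (\<parallel>r\<^sub>t - u\<parallel>\<^sup>2 - \<parallel>r\<^sub>t\<^sub>+\<^sub>1 - u\<parallel>\<^sup>2 - (1 - c\<^sup>2) \<parallel>r\<^sub>t - w\<^sub>t\<^sub>+\<^sub>1\<parallel>\<^sup>2)\<close>,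
  and dividing by \<open>\<Gamma>\<^sub>t\<close> makes this telescope because \<open>\<alpha>\<^sub>t/(\<Gamma>\<^sub>t\<gamma>\<^sub>t)\<close> is constant.
  At \<open>u = u\<^sup>*\<close>, where \<open>Q \<ge> 0\<close>, the telescoped inequality bounds both \<open>\<parallel>r\<^sub>t\<^sub>+\<^sub>1 - u\<^sup>*\<parallel>\<close> and
  \<open>\<Sum> \<parallel>r\<^sub>i - w\<^sub>i\<^sub>+\<^sub>1\<parallel>\<^sup>2\<close> by \<open>D\<close>.
  For general \<open>u\<close>, expanding the squares around \<open>w\<^sup>a\<^sup>g\<^sub>t\<^sub>+\<^sub>1\<close> leaves the linear term
  \<open>\<langle>v, w\<^sup>a\<^sup>g\<^sub>t\<^sub>+\<^sub>1 - u\<rangle>\<close> with \<open>v = (\<alpha>\<^sub>t/\<gamma>\<^sub>t) (r\<^sub>1 - r\<^sub>t\<^sub>+\<^sub>1)\<close> and a remainder that is at most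
  \<open>\<alpha>\<^sub>t/(2\<gamma>\<^sub>t) \<parallel>r\<^sub>1 - w\<^sup>a\<^sup>g\<^sub>t\<^sub>+\<^sub>1\<parallel>\<^sup>2\<close>; the latter is estimated by writing \<open>w\<^sup>a\<^sup>g\<^sub>t\<^sub>+\<^sub>1\<close> as a convex
  combination of the \<open>w\<^sub>i\<^sub>+\<^sub>1\<close>.
\<close>

section \<open>Optimality in the prox-mapping and the extragradient step\<close>

lemma nonneg_if_nonneg_add_small:
  fixes A B :: real
  assumes "\<And>s. 0 < s \<Longrightarrow> s < 1 \<Longrightarrow> 0 \<le> A + s * B"
  shows "0 \<le> A"
proof (rule tendsto_lowerbound)
  show "((\<lambda>s. A + s * B) \<longlongrightarrow> A) (at_right 0)"
    by (auto intro!: tendsto_eq_intros)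
  show "\<forall>\<^sub>F s in at_right 0. 0 \<le> A + s * B"
    using assms by (auto simp: eventually_at_right_field intro!: exI[of _ 1])
qed simp

text \<open>Comparing \<open>p\<close> with the points (1 - s) p + s u of the segment, dividing by
  \<open>s\<close> and letting s tend to 0 yields the first-order condition without a derivative of
  \<open>J\<close>. Expanding <p - z, u - p> then produces the three squares.\<close>

lemma prox_variational_inequality:
  fixes Z :: "'a::euclidean_space set"
  assumes Z: "convex Z" and J: "convex_on Z J"
    and V: "\<And>r z. r \<in> Z \<Longrightarrow> z \<in> Z \<Longrightarrow> V r z = (norm (z - r))\<^sup>2 / 2"
    and wd: "prox_well_defined Z V J"
    and z: "z \<in> Z" and \<gamma>: "\<gamma> > 0" and p: "p = prox Z V J \<gamma> z \<eta>"
  shows "p \<in> Z"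
    and "u \<in> Z \<Longrightarrow> \<eta> \<bullet> (p - u) + \<gamma> * (J p - J u)
           \<le> ((norm (z - u))\<^sup>2 - (norm (p - u))\<^sup>2 - (norm (z - p))\<^sup>2) / 2"
proof -
  have am: "is_arg_min (prox_objective V J \<gamma> z \<eta>) (\<lambda>u. u \<in> Z) p"
    unfolding p prox_def arg_min_on_def arg_min_def
    using wd z \<gamma> unfolding prox_well_defined_def by (metis (mono_tags, lifting) someI_ex)
  then show pZ: "p \<in> Z" by (simp add: is_arg_min_def)
  assume u: "u \<in> Z"
  let ?A = "\<eta> \<bullet> (u - p) + (p - z) \<bullet> (u - p) + \<gamma> * (J u - J p)"
  have "0 \<le> ?A"
  proof (rule nonneg_if_nonneg_add_small[where B = "(norm (u - p))\<^sup>2 / 2"])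
    fix s :: real assume s: "0 < s" "s < 1"
    define q where "q = (1 - s) *\<^sub>R p + s *\<^sub>R u"
    have q: "q \<in> Z" unfolding q_def using Z pZ u s by (simp add: convexD)
    have qp: "q - z = (p - z) + s *\<^sub>R (u - p)" unfolding q_def by (simp add: algebra_simps)
    have "J q \<le> (1 - s) * J p + s * J u"
      unfolding q_def using convex_onD[OF J, of s p u] s pZ u by simp
    then have "\<gamma> * J q \<le> \<gamma> * ((1 - s) * J p + s * J u)" using \<gamma> by simp
    moreover have "prox_objective V J \<gamma> z \<eta> p \<le> prox_objective V J \<gamma> z \<eta> q"
      using am q by (simp add: is_arg_min_linorder)
    then have "\<eta> \<bullet> (p - z) + (norm (p - z))\<^sup>2 / 2 + \<gamma> * J p
        \<le> \<eta> \<bullet> (q - z) + (norm (q - z))\<^sup>2 / 2 + \<gamma> * J q"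
      using V z pZ q by (simp add: prox_objective_def)
    moreover have "\<eta> \<bullet> (q - z) = \<eta> \<bullet> (p - z) + s * (\<eta> \<bullet> (u - p))"
      unfolding qp by (simp add: inner_add_right)
    moreover have "(norm (q - z))\<^sup>2 =
        (norm (p - z))\<^sup>2 + 2 * s * ((p - z) \<bullet> (u - p)) + s * s * (norm (u - p))\<^sup>2"
      unfolding qp power2_norm_eq_inner
      by (simp add: inner_add_left inner_add_right inner_commute[of "u - p" "p - z"] distrib_left)
    ultimately have "0 \<le> s * (\<eta> \<bullet> (u - p)) + s * ((p - z) \<bullet> (u - p))
        + s * s * (norm (u - p))\<^sup>2 / 2 + (\<gamma> * ((1 - s) * J p + s * J u) - \<gamma> * J p)"
      by (simp add: field_simps)
    also have "\<dots> = s * (?A + s * ((norm (u - p))\<^sup>2 / 2))"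
      by (simp add: algebra_simps)
    finally have "0 \<le> s * (?A + s * ((norm (u - p))\<^sup>2 / 2))" .
    then show "0 \<le> ?A + s * ((norm (u - p))\<^sup>2 / 2)"
      using s by (simp add: zero_le_mult_iff)
  qed
  moreover have "(p - z) \<bullet> (u - p)
      = ((norm (z - u))\<^sup>2 - (norm (p - u))\<^sup>2 - (norm (z - p))\<^sup>2) / 2"
    by (simp add: power2_norm_eq_inner inner_diff inner_commute)
  moreover have "\<eta> \<bullet> (p - u) = - (\<eta> \<bullet> (u - p))"
    by (simp add: inner_diff_right)
  ultimately show "\<eta> \<bullet> (p - u) + \<gamma> * (J p - J u)
      \<le> ((norm (z - u))\<^sup>2 - (norm (p - u))\<^sup>2 - (norm (z - p))\<^sup>2) / 2"
    by (simp add: algebra_simps)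
qed

text \<open>The first prox inequality is used at \<open>u = r'\<close>, the second at an arbitrary \<open>u\<close>. Their sum
  contains the term \<open>\<gamma> \<langle>h\<^sub>w - h\<^sub>r, w - r'\<rangle>\<close>, which Young's inequality absorbs.\<close>

lemma extragradient_step:
  fixes r w r' u g hr hw :: "'a::real_inner" and \<gamma> L Jw Jr Ju :: real
  assumes 1: "(\<gamma> *\<^sub>R hr + \<gamma> *\<^sub>R g) \<bullet> (w - r') + \<gamma> * (Jw - Jr)
        \<le> ((norm (r - r'))\<^sup>2 - (norm (w - r'))\<^sup>2 - (norm (r - w))\<^sup>2) / 2"
    and 2: "(\<gamma> *\<^sub>R hw + \<gamma> *\<^sub>R g) \<bullet> (r' - u) + \<gamma> * (Jr - Ju)
        \<le> ((norm (r - u))\<^sup>2 - (norm (r' - u))\<^sup>2 - (norm (r - r'))\<^sup>2) / 2"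
    and L: "norm (hw - hr) \<le> L * norm (w - r)"
  shows "2 * \<gamma> * ((hw + g) \<bullet> (w - u) + Jw - Ju)
    \<le> (norm (r - u))\<^sup>2 - (norm (r' - u))\<^sup>2 - (1 - L\<^sup>2 * \<gamma>\<^sup>2) * (norm (r - w))\<^sup>2"
proof -
  have "0 \<le> (norm (\<gamma> *\<^sub>R (hw - hr) - (w - r')))\<^sup>2" by simp
  also have "\<dots> = (norm (\<gamma> *\<^sub>R (hw - hr)))\<^sup>2 + (norm (w - r'))\<^sup>2
      - 2 * ((\<gamma> *\<^sub>R (hw - hr)) \<bullet> (w - r'))"
    using dot_norm_neg[of "\<gamma> *\<^sub>R (hw - hr)" "w - r'"] by simp
  finally have young: "2 * (\<gamma> * ((hw - hr) \<bullet> (w - r')))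
      \<le> \<gamma>\<^sup>2 * (norm (hw - hr))\<^sup>2 + (norm (w - r'))\<^sup>2"
    by (simp add: power_mult_distrib)
  have "(norm (hw - hr))\<^sup>2 \<le> (L * norm (w - r))\<^sup>2"
    using L by (intro power_mono) auto
  then have "\<gamma>\<^sup>2 * (norm (hw - hr))\<^sup>2 \<le> \<gamma>\<^sup>2 * (L * norm (w - r))\<^sup>2"
    by (intro mult_left_mono) auto
  also have "\<dots> = L\<^sup>2 * \<gamma>\<^sup>2 * (norm (r - w))\<^sup>2"
    by (simp add: power_mult_distrib norm_minus_commute)
  finally have lip: "\<gamma>\<^sup>2 * (norm (hw - hr))\<^sup>2 \<le> L\<^sup>2 * \<gamma>\<^sup>2 * (norm (r - w))\<^sup>2" .
  \<comment> \<open>The first two terms are those of \<open>1\<close> and \<open>2\<close>; the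
    third is the error of evaluating \<open>H\<close> at \<open>r\<close> in the first prox
    step.\<close>
  have split: "\<gamma> * ((hw + g) \<bullet> (w - u)) = (\<gamma> *\<^sub>R hr + \<gamma> *\<^sub>R g) \<bullet> (w - r')
      + (\<gamma> *\<^sub>R hw + \<gamma> *\<^sub>R g) \<bullet> (r' - u) + \<gamma> * ((hw - hr) \<bullet> (w - r'))"
    by (simp add: inner_add_left inner_diff algebra_simps)
  have "2 * \<gamma> * ((hw + g) \<bullet> (w - u) + Jw - Ju)
      = 2 * (\<gamma> * ((hw + g) \<bullet> (w - u))) + 2 * \<gamma> * (Jw - Ju)"
    by (simp add: algebra_simps)
  then show ?thesis
    using 1 2 young lip unfolding split by (simp add: algebra_simps)
qed

section \<open>Estimates for the gap function\<close>

text \<open>Linearize \<open>G\<close> at \<open>md\<close>: since y - md = a (w - r), the error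
  carries a^2. The linearization splits along y = (1 - a) x + a w, and its values at
  \<open>x\<close> and \<open>u\<close> lie below \<open>G\<close>. Monotonicity replaces
  \<open>H u\<close> by \<open>H w\<close>, the value the method computes.\<close>

lemma Q_gap_convex_step:
  fixes Z :: "'a::euclidean_space set"
  assumes Z: "convex Z" and J: "convex_on Z J"
    and G: "\<And>w v. w \<in> Z \<Longrightarrow> v \<in> Z \<Longrightarrow>
          0 \<le> G w - G v - gradG v \<bullet> (w - v) \<and>
          G w - G v - gradG v \<bullet> (w - v) \<le> L / 2 * (norm (w - v))\<^sup>2"
    and mono: "\<And>w v. w \<in> Z \<Longrightarrow> v \<in> Z \<Longrightarrow> (H w - H v) \<bullet> (w - v) \<ge> 0"
    and a: "0 \<le> a" "a \<le> 1" and x: "x \<in> Z" and r: "r \<in> Z" and w: "w \<in> Z" and u: "u \<in> Z"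
    and md: "md = (1 - a) *\<^sub>R x + a *\<^sub>R r" and y: "y = (1 - a) *\<^sub>R x + a *\<^sub>R w"
  shows "Q_gap G H J y u \<le> (1 - a) * Q_gap G H J x u
    + a * ((H w + gradG md) \<bullet> (w - u) + J w - J u) + L / 2 * a\<^sup>2 * (norm (r - w))\<^sup>2"
proof -
  have mdZ: "md \<in> Z" and yZ: "y \<in> Z"
    unfolding md y using Z x r w a by (simp_all add: convexD)
  have ymd: "y - md = a *\<^sub>R (w - r)"
    unfolding md y by (simp add: algebra_simps)
  have "G y \<le> G md + gradG md \<bullet> (y - md) + L / 2 * (norm (y - md))\<^sup>2"
    using G[OF yZ mdZ] by simp
  also have "(norm (y - md))\<^sup>2 = a\<^sup>2 * (norm (r - w))\<^sup>2"
    unfolding ymd by (simp add: power_mult_distrib norm_minus_commute)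
  also have "G md + gradG md \<bullet> (y - md)
      = (1 - a) * (G md + gradG md \<bullet> (x - md))
        + a * (G md + gradG md \<bullet> (u - md)) + a * (gradG md \<bullet> (w - u))"
    unfolding y by (simp add: inner_add_right inner_diff_right algebra_simps)
  also have "(1 - a) * (G md + gradG md \<bullet> (x - md)) \<le> (1 - a) * G x"
    using G[OF x mdZ] a by (intro mult_left_mono) auto
  also have "a * (G md + gradG md \<bullet> (u - md)) \<le> a * G u"
    using G[OF u mdZ] a by (intro mult_left_mono) auto
  finally have Gy: "G y \<le> (1 - a) * G x + a * G u + a * (gradG md \<bullet> (w - u))
      + L / 2 * (a\<^sup>2 * (norm (r - w))\<^sup>2)" by simp
  have Jy: "J y \<le> (1 - a) * J x + a * J w"
    unfolding y using convex_onD[OF J, of a x w] a x w by simp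
  have "H u \<bullet> (w - u) \<le> H w \<bullet> (w - u)"
    using mono[OF w u] by (simp add: inner_diff_left)
  then have Hw: "a * (H u \<bullet> (w - u)) \<le> a * (H w \<bullet> (w - u))"
    using a by (intro mult_left_mono) auto
  have "H u \<bullet> (y - u) = (1 - a) * (H u \<bullet> (x - u)) + a * (H u \<bullet> (w - u))"
    unfolding y by (simp add: inner_add_right inner_diff_right algebra_simps)
  then show ?thesis
    using Gy Jy Hw unfolding Q_gap_def by (simp add: inner_add_left algebra_simps)
qed

text \<open>The linear lower bounds of \<open>G\<close> and \<open>J\<close> at \<open>us\<close>
  give Q(x, us) >= <F(us), x - us>, where F is the operator of the inequality.\<close>

lemma Q_gap_strong_solution_nonneg:
  fixes Z :: "'a::euclidean_space set"
  assumes us: "strong_solution Z (\<lambda>u. gradG u + H u + J' u) us"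
    and G: "G x - G us - gradG us \<bullet> (x - us) \<ge> 0"
    and J: "J' us \<in> subdifferential Z J us" and x: "x \<in> Z"
  shows "0 \<le> Q_gap G H J x us"
proof -
  have "(gradG us + H us + J' us) \<bullet> (us - x) \<le> 0"
    using us x by (simp add: strong_solution_def)
  moreover have "J us + J' us \<bullet> (x - us) \<le> J x"
    using J x by (simp add: subdifferential_def)
  ultimately show ?thesis
    using G unfolding Q_gap_def by (simp add: inner_add_left inner_diff_right)
qed

section \<open>The weights \<open>Gam\<close> and the averages they define\<close>

lemma Gam_pos:
  assumes "\<And>t. t > 1 \<Longrightarrow> \<alpha> t < 1"
  shows "Gam \<alpha> t > 0"
  using assms by (induction t) auto

text \<open>Weighted sums obey the same recursion as \<open>w_ag\<close>, so averages can be treated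
  by induction; positivity of \<open>Gam\<close> lets the last weight cancel.\<close>

lemma Gam_weighted_sum_rec:
  assumes "\<And>t. t > 1 \<Longrightarrow> \<alpha> t < 1" and "t \<ge> 1"
  shows "Gam \<alpha> (Suc t) * (\<Sum>i=1..Suc t. \<alpha> i / Gam \<alpha> i * f i)
    = (1 - \<alpha> (Suc t)) * (Gam \<alpha> t * (\<Sum>i=1..t. \<alpha> i / Gam \<alpha> i * f i)) + \<alpha> (Suc t) * f (Suc t)"
proof -
  have "Gam \<alpha> (Suc t) > 0" using assms(1) by (rule Gam_pos)
  then show ?thesis using assms(2) by (auto simp: distrib_left)
qed

lemma Gam_weights_sum_one:
  assumes "\<alpha> 1 = 1" "\<And>t. t > 1 \<Longrightarrow> \<alpha> t < 1" "t \<ge> 1"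
  shows "Gam \<alpha> t * (\<Sum>i=1..t. \<alpha> i / Gam \<alpha> i) = 1"
  using assms(3)
proof (induction t rule: dec_induct)
  case base
  then show ?case using assms(1) by simp
next
  case (step n)
  then show ?case using Gam_weighted_sum_rec[of \<alpha> n "\<lambda>_. 1"] assms(2) by simp
qed

lemma norm_convex_combination_squared_le:
  fixes p q :: "'a::real_inner"
  assumes "0 \<le> a" "a \<le> 1"
  shows "(norm ((1 - a) *\<^sub>R p + a *\<^sub>R q))\<^sup>2 \<le> (1 - a) * (norm p)\<^sup>2 + a * (norm q)\<^sup>2"
proof -
  have "(norm ((1 - a) *\<^sub>R p + a *\<^sub>R q))\<^sup>2
      = (1 - a) * (norm p)\<^sup>2 + a * (norm q)\<^sup>2 - a * (1 - a) * (norm (p - q))\<^sup>2"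
    unfolding power2_norm_eq_inner
    by (simp add: inner_add_left inner_add_right inner_diff_left inner_diff_right
        inner_commute[of q p] algebra_simps)
  moreover have "0 \<le> a * (1 - a) * (norm (p - q))\<^sup>2" using assms by simp
  ultimately show ?thesis by linarith
qed

text \<open>Jensen's inequality for the average
  \<open>x\<^sub>t\<^sub>+\<^sub>1 = \<Gamma>\<^sub>t \<Sum>\<^sub>i\<^sub>\<le>\<^sub>t (\<alpha>\<^sub>i / \<Gamma>\<^sub>i) w\<^sub>i\<^sub>+\<^sub>1\<close>.\<close>

lemma averaged_sequence_norm_le:
  fixes x w :: "nat \<Rightarrow> 'a::real_inner"
  assumes \<alpha>: "\<alpha> 1 = 1" "\<And>t. t > 1 \<Longrightarrow> 0 \<le> \<alpha> t \<and> \<alpha> t < 1"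
    and x: "\<And>t. t \<ge> 1 \<Longrightarrow> x (t + 1) = (1 - \<alpha> t) *\<^sub>R x t + \<alpha> t *\<^sub>R w (t + 1)"
    and t: "t \<ge> 1"
  shows "(norm (p - x (t + 1)))\<^sup>2
    \<le> Gam \<alpha> t * (\<Sum>i=1..t. \<alpha> i / Gam \<alpha> i * (norm (p - w (i + 1)))\<^sup>2)"
  using t
proof (induction t rule: dec_induct)
  \<comment> \<open>As \<open>\<alpha> 1 = 1\<close>, the starting point \<open>x 1\<close> drops
    out of the average.\<close>
  case base
  then show ?case using x[of 1] \<alpha>(1) by simp
next
  case (step n)
  let ?a = "\<alpha> (Suc n)" and ?y = "x (Suc n)" and ?z = "w (Suc n + 1)"
  have a: "0 \<le> ?a" "?a < 1" using \<alpha>(2)[of "Suc n"] step by auto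
  have "p - x (Suc n + 1) = (1 - ?a) *\<^sub>R (p - ?y) + ?a *\<^sub>R (p - ?z)"
    using x[of "Suc n"] by (simp add: algebra_simps)
  then have "(norm (p - x (Suc n + 1)))\<^sup>2
      \<le> (1 - ?a) * (norm (p - ?y))\<^sup>2 + ?a * (norm (p - ?z))\<^sup>2"
    using norm_convex_combination_squared_le[of ?a] a by simp
  also have "\<dots> \<le> (1 - ?a) * (Gam \<alpha> n * (\<Sum>i=1..n. \<alpha> i / Gam \<alpha> i * (norm (p - w (i + 1)))\<^sup>2))
      + ?a * (norm (p - ?z))\<^sup>2"
    using step.IH a by (intro add_right_mono mult_left_mono) auto
  also have "\<dots> = Gam \<alpha> (Suc n) * (\<Sum>i=1..Suc n. \<alpha> i / Gam \<alpha> i * (norm (p - w (i + 1)))\<^sup>2)"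
    using Gam_weighted_sum_rec[of \<alpha> n "\<lambda>i. (norm (p - w (i + 1)))\<^sup>2"] \<alpha>(2) step by simp
  finally show ?case .
qed

text \<open>The difference of the two sides is the sum of the three pairwise squared
  distances.\<close>

lemma norm_add3_squared_le:
  fixes a b c :: "'a::real_inner"
  shows "(norm (a + b + c))\<^sup>2 \<le> 3 * ((norm a)\<^sup>2 + (norm b)\<^sup>2 + (norm c)\<^sup>2)"
proof -
  have "0 \<le> (norm (a - b))\<^sup>2 + (norm (b - c))\<^sup>2 + (norm (a - c))\<^sup>2" by simp
  also have "\<dots> = 3 * ((norm a)\<^sup>2 + (norm b)\<^sup>2 + (norm c)\<^sup>2) - (norm (a + b + c))\<^sup>2"
    unfolding power2_norm_eq_inner
    by (simp add: inner_add_left inner_add_right inner_diff_left inner_diff_right inner_commute)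
  finally show ?thesis by simp
qed

theorem theorem2p3:
  fixes Z :: "'a::euclidean_space set"
    and G J :: "'a \<Rightarrow> real"
    and gradG H J' :: "'a \<Rightarrow> 'a"
    and V :: "'a \<Rightarrow> 'a \<Rightarrow> real"
    and L_G L_H c D :: real
    and \<alpha> \<gamma> :: "nat \<Rightarrow> real"
    and r w w_ag w_md :: "nat \<Rightarrow> 'a"
    and ustar :: 'a
  assumes Z: "Z \<noteq> {}" "closed Z" "convex Z"
    and G_C1: "continuously_differentiable_on Z G gradG"
    and G_bounds: "\<And>w v. w \<in> Z \<Longrightarrow> v \<in> Z \<Longrightarrow>
          0 \<le> G w - G v - gradG v \<bullet> (w - v) \<and>
          G w - G v - gradG v \<bullet> (w - v) \<le> L_G / 2 * (norm (w - v))\<^sup>2"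
    and H_monotone: "\<And>w v. w \<in> Z \<Longrightarrow> v \<in> Z \<Longrightarrow> (H w - H v) \<bullet> (w - v) \<ge> 0"
    and H_Lipschitz: "\<And>w v. w \<in> Z \<Longrightarrow> v \<in> Z \<Longrightarrow> norm (H w - H v) \<le> L_H * norm (w - v)"
    and J_convex: "convex_on Z J"
    and J_subgradient: "\<And>u. u \<in> Z \<Longrightarrow> J' u \<in> subdifferential Z J u"
    and V: "\<And>r z. r \<in> Z \<Longrightarrow> z \<in> Z \<Longrightarrow> V r z = (norm (z - r))\<^sup>2 / 2"
    and prox: "prox_well_defined Z V J"
    and ustar: "strong_solution Z (\<lambda>u. gradG u + H u + J' u) ustar"
    and AMP: "AMP Z V gradG H J \<alpha> \<gamma> r w w_ag w_md"
    and gamma_pos: "\<And>t. t \<ge> 1 \<Longrightarrow> \<gamma> t > 0"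
    and alpha_1: "\<alpha> 1 = 1"
    and alpha: "\<And>t. t > 1 \<Longrightarrow> 0 \<le> \<alpha> t \<and> \<alpha> t < 1"
    and c: "0 \<le> c" "c < 1"
    and step: "\<And>t. t \<ge> 1 \<Longrightarrow> L_G * \<alpha> t * \<gamma> t + L_H\<^sup>2 * (\<gamma> t)\<^sup>2 \<le> c\<^sup>2"
    and ratio: "\<And>t. t \<ge> 1 \<Longrightarrow>
          \<alpha> t / (Gam \<alpha> t * \<gamma> t) = \<alpha> (t + 1) / (Gam \<alpha> (t + 1) * \<gamma> (t + 1))"
    and D: "D = norm (r 1 - ustar)"
  shows "\<forall>t\<ge>1. \<exists>v \<epsilon>. \<epsilon> \<ge> 0 \<and>
           perturbed_gap Z G H J (w_ag (t + 1)) v \<le> ereal \<epsilon> \<and>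
           norm v \<le> 2 * \<alpha> t * D / \<gamma> t \<and>
           \<epsilon> \<le> 3 * \<alpha> t * (1 + theta \<alpha> c t) * D\<^sup>2 / \<gamma> t"
proof (intro allI impI)
  fix t :: nat assume t: "t \<ge> 1"
  note \<alpha>_lt = conjunct2[OF alpha]
  have us: "ustar \<in> Z" using ustar by (simp add: strong_solution_def)
  have init: "r 1 \<in> Z" "w_ag 1 = r 1"
    and md: "\<And>t. t \<ge> 1 \<Longrightarrow> w_md t = (1 - \<alpha> t) *\<^sub>R w_ag t + \<alpha> t *\<^sub>R r t"
    and wp: "\<And>t. t \<ge> 1 \<Longrightarrow> w (t + 1)
        = prox Z V J (\<gamma> t) (r t) (\<gamma> t *\<^sub>R H (r t) + \<gamma> t *\<^sub>R gradG (w_md t))"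
    and rp: "\<And>t. t \<ge> 1 \<Longrightarrow> r (t + 1)
        = prox Z V J (\<gamma> t) (r t) (\<gamma> t *\<^sub>R H (w (t + 1)) + \<gamma> t *\<^sub>R gradG (w_md t))"
    and ag: "\<And>t. t \<ge> 1 \<Longrightarrow> w_ag (t + 1) = (1 - \<alpha> t) *\<^sub>R w_ag t + \<alpha> t *\<^sub>R w (t + 1)"
    using AMP unfolding AMP_def by auto
  have prox_vi: "p \<in> Z"
    "u \<in> Z \<Longrightarrow> \<eta> \<bullet> (p - u) + \<gamma> t * (J p - J u)
       \<le> ((norm (z - u))\<^sup>2 - (norm (p - u))\<^sup>2 - (norm (z - p))\<^sup>2) / 2"
    if "z \<in> Z" "t \<ge> 1" "p = prox Z V J (\<gamma> t) z \<eta>" for z t p \<eta> u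
    using prox_variational_inequality(1)[of Z J V z "\<gamma> t" p \<eta>]
      prox_variational_inequality(2)[of Z J V z "\<gamma> t" p \<eta> u]
      Z(3) J_convex V prox gamma_pos that
    by blast+
  have \<alpha>01: "0 \<le> \<alpha> t" "\<alpha> t \<le> 1" if "t \<ge> 1" for t
    using alpha[of t] alpha_1 that by (cases "t = 1"; force)+
  have rZ: "r t \<in> Z" if "t \<ge> 1" for t
    using that
  proof (induction t rule: dec_induct)
    case (step n)
    then show ?case using prox_vi(1)[OF step.IH step.hyps(1) rp[OF step.hyps(1)]] by simp
  qed (rule init)
  have wZ: "w (t + 1) \<in> Z" if "t \<ge> 1" for t
    using prox_vi(1)[OF rZ[OF that] that wp[OF that]] .
  have agZ: "w_ag t \<in> Z" if "t \<ge> 1" for t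
    using that
  proof (induction t rule: dec_induct)
    case (step n)
    then show ?case using ag[of n] wZ[of n] \<alpha>01[of n] Z(3) by (simp add: convexD)
  qed (use init in simp)
  have Gpos: "Gam \<alpha> t > 0" for t by (rule Gam_pos) (rule \<alpha>_lt)
  \<comment> \<open>The common value of the constant ratio, read off at t = 1, where
    \<open>\<alpha>\<close> and \<open>Gam\<close> are both 1.\<close>
  define k where "k = 1 / \<gamma> 1"
  have k: "k > 0" using gamma_pos[of 1] by (simp add: k_def)
  have ratio_k: "\<alpha> t / \<gamma> t = Gam \<alpha> t * k" if "t \<ge> 1" for t
  proof -
    have "\<alpha> t / (Gam \<alpha> t * \<gamma> t) = k"
      using that
    proof (induction t rule: dec_induct)
      case base
      show ?case using alpha_1 by (simp add: k_def)
    next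
      case (step n)
      then show ?case using ratio[of n] by simp
    qed
    then show ?thesis using Gpos[of t] by (auto simp: field_simps)
  qed

  \<comment> \<open>Telescoping the gap inequality and bounding the iterates\<close>
  have one_step: "Q_gap G H J (w_ag (t + 1)) u \<le> (1 - \<alpha> t) * Q_gap G H J (w_ag t) u
      + Gam \<alpha> t * k / 2 * ((norm (r t - u))\<^sup>2 - (norm (r (t + 1) - u))\<^sup>2
          - (1 - c\<^sup>2) * (norm (r t - w (t + 1)))\<^sup>2)"
    if t: "t \<ge> 1" and u: "u \<in> Z" for t u
  proof -
    let ?N = "(norm (r t - w (t + 1)))\<^sup>2"
    let ?S = "(H (w (t + 1)) + gradG (w_md t)) \<bullet> (w (t + 1) - u) + J (w (t + 1)) - J u"
    let ?R = "(norm (r t - u))\<^sup>2 - (norm (r (t + 1) - u))\<^sup>2"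
    have \<gamma>: "\<gamma> t > 0" using gamma_pos t by blast
    have rZ': "r (t + 1) \<in> Z" using rZ t by simp
    have e1: "(\<alpha> t / (2 * \<gamma> t)) * (2 * \<gamma> t * s) = \<alpha> t * s" for s
      using \<gamma> by simp
    \<comment> \<open>Relative to the factor \<open>\<alpha> t / (2 * \<gamma> t)\<close>, the
      smoothness error of \<open>G\<close> has coefficient
      \<open>L_G * \<alpha> t * \<gamma> t\<close>. It thus joins the Lipschitz error of
      \<open>H\<close> to form exactly the left side of the step-size condition.\<close>
    have e2: "(\<alpha> t / (2 * \<gamma> t)) * (x - (1 - (L_G * \<alpha> t * \<gamma> t + L_H\<^sup>2 * (\<gamma> t)\<^sup>2)) * n)
        = (\<alpha> t / (2 * \<gamma> t)) * (x - (1 - L_H\<^sup>2 * (\<gamma> t)\<^sup>2) * n) + L_G / 2 * (\<alpha> t)\<^sup>2 * n" for x n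
      using \<gamma> by (simp add: field_simps power2_eq_square)
    have "2 * \<gamma> t * ?S \<le> ?R - (1 - L_H\<^sup>2 * (\<gamma> t)\<^sup>2) * ?N"
      by (rule extragradient_step[OF prox_vi(2)[OF rZ[OF t] t wp[OF t] rZ']
            prox_vi(2)[OF rZ[OF t] t rp[OF t] u]
            H_Lipschitz[OF wZ[OF t] rZ[OF t]]])
    then have "(\<alpha> t / (2 * \<gamma> t)) * (2 * \<gamma> t * ?S)
        \<le> (\<alpha> t / (2 * \<gamma> t)) * (?R - (1 - L_H\<^sup>2 * (\<gamma> t)\<^sup>2) * ?N)"
      using \<alpha>01[OF t] \<gamma> by (intro mult_left_mono) auto
    then have "\<alpha> t * ?S + L_G / 2 * (\<alpha> t)\<^sup>2 * ?N
        \<le> (\<alpha> t / (2 * \<gamma> t)) * (?R - (1 - (L_G * \<alpha> t * \<gamma> t + L_H\<^sup>2 * (\<gamma> t)\<^sup>2)) * ?N)"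
      unfolding e1 e2 by linarith
    also have "\<dots> \<le> (\<alpha> t / (2 * \<gamma> t)) * (?R - (1 - c\<^sup>2) * ?N)"
      using step[OF t] \<alpha>01[OF t] \<gamma> by (intro mult_left_mono diff_left_mono mult_right_mono) auto
    also have "\<alpha> t / (2 * \<gamma> t) = Gam \<alpha> t * k / 2" using ratio_k[OF t] by simp
    finally have "\<alpha> t * ?S + L_G / 2 * (\<alpha> t)\<^sup>2 * ?N
        \<le> Gam \<alpha> t * k / 2 * (?R - (1 - c\<^sup>2) * ?N)" .
    moreover have "Q_gap G H J (w_ag (t + 1)) u
        \<le> (1 - \<alpha> t) * Q_gap G H J (w_ag t) u + \<alpha> t * ?S + L_G / 2 * (\<alpha> t)\<^sup>2 * ?N"
      by (rule Q_gap_convex_step[OF Z(3) J_convex])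
        (fact G_bounds H_monotone \<alpha>01[OF t] agZ[OF t] rZ[OF t] wZ[OF t] u md[OF t] ag[OF t])+
    ultimately show ?thesis by linarith
  qed
  define S where "S t = (\<Sum>i=1..t. (norm (r i - w (i + 1)))\<^sup>2)" for t
  have tele: "Q_gap G H J (w_ag (t + 1)) u \<le> Gam \<alpha> t * k / 2 *
      ((norm (r 1 - u))\<^sup>2 - (norm (r (t + 1) - u))\<^sup>2 - (1 - c\<^sup>2) * S t)"
    if t: "t \<ge> 1" and u: "u \<in> Z" for t u
    using t
  proof (induction t rule: dec_induct)
    \<comment> \<open>\<open>\<alpha> 1 = 1\<close> removes the gap at the initial point, which
      could not be bounded otherwise.\<close>
    case base
    show ?case using one_step[of 1 u] u alpha_1 by (simp add: S_def)
  next
    case (step n)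
    have "(1 - \<alpha> (Suc n)) * Q_gap G H J (w_ag (Suc n)) u \<le> (1 - \<alpha> (Suc n)) *
        (Gam \<alpha> n * k / 2 * ((norm (r 1 - u))\<^sup>2 - (norm (r (n + 1) - u))\<^sup>2 - (1 - c\<^sup>2) * S n))"
      using step.IH \<alpha>01[of "Suc n"] by (intro mult_left_mono) auto
    also have "\<dots> = Gam \<alpha> (Suc n) * k / 2 *
        ((norm (r 1 - u))\<^sup>2 - (norm (r (Suc n) - u))\<^sup>2 - (1 - c\<^sup>2) * S n)"
      using step.hyps by simp
    finally show ?case
      using one_step[of "Suc n" u] u by (simp add: S_def algebra_simps)
  qed
  have c2: "1 - c\<^sup>2 > 0" using c by (simp add: power_less_one_iff abs_square_less_1)
  have S_nonneg: "S t \<ge> 0" for t unfolding S_def by (intro sum_nonneg) simp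
  have bound: "(norm (r (t + 1) - ustar))\<^sup>2 + (1 - c\<^sup>2) * S t \<le> D\<^sup>2" if t: "t \<ge> 1" for t
  proof -
    have x: "w_ag (t + 1) \<in> Z" using agZ t by simp
    have "0 \<le> Q_gap G H J (w_ag (t + 1)) ustar"
      using Q_gap_strong_solution_nonneg[OF ustar _ J_subgradient[OF us] x] G_bounds[OF x us] by simp
    also have "\<dots> \<le> Gam \<alpha> t * k / 2 *
        ((norm (r 1 - ustar))\<^sup>2 - (norm (r (t + 1) - ustar))\<^sup>2 - (1 - c\<^sup>2) * S t)"
      using tele t us by blast
    finally show ?thesis
      using mult_pos_pos[OF Gpos[of t] k] by (auto simp: zero_le_mult_iff D)
  qed
  have D0: "D \<ge> 0" using D by simp
  have r_us: "norm (r i - ustar) \<le> D" if i: "i \<ge> 1" for i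
  proof (cases "i = 1")
    case False
    \<comment> \<open>\<open>bound\<close> speaks of \<open>r (j + 1)\<close> with j >= 1 only; the
      index 1 is the definition of \<open>D\<close>.\<close>
    define j where "j = i - 1"
    have j: "i = j + 1" "j \<ge> 1" using i False by (auto simp: j_def)
    have "0 \<le> (1 - c\<^sup>2) * S j" using c2 S_nonneg by simp
    then have "(norm (r i - ustar))\<^sup>2 \<le> D\<^sup>2" using bound[OF j(2)] j(1) by simp
    then show ?thesis using D0 by (rule power2_le_imp_le)
  qed (simp add: D)

  \<comment> \<open>Distance from the starting point to the averaged iterate\<close>
  let ?x = "w_ag (t + 1)" and ?M = "Max ((\<lambda>i. \<alpha> i / Gam \<alpha> i) ` {1..t})"
  let ?p = "\<lambda>i. \<alpha> i / Gam \<alpha> i" and ?d = "\<lambda>i. (norm (r i - w (i + 1)))\<^sup>2"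
  have p_nonneg: "0 \<le> ?p i" if "i \<in> {1..t}" for i using \<alpha>01[of i] Gpos[of i] that by simp
  have p_le: "?p i \<le> ?M" if "i \<in> {1..t}" for i
    using that by (intro Max_ge) auto
  have M: "0 \<le> ?M" using p_nonneg[of 1] p_le[of 1] t by auto
  \<comment> \<open>\<open>bound\<close> controls the unweighted sum \<open>S t\<close>, so each
    weight is replaced by the largest one: this is the maximum in \<open>theta\<close>.\<close>
  have "(\<Sum>i=1..t. ?p i * ?d i) \<le> (\<Sum>i=1..t. ?M * ?d i)"
    using p_le by (intro sum_mono mult_right_mono) auto
  also have "\<dots> = ?M * S t" by (simp add: S_def sum_distrib_left)
  also have "S t \<le> D\<^sup>2 / (1 - c\<^sup>2)"
    unfolding pos_le_divide_eq[OF c2] mult.commute[of "S t"]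
    using bound[OF t] zero_le_power2[of "norm (r (t + 1) - ustar)"] by linarith
  finally have "(\<Sum>i=1..t. ?p i * ?d i) \<le> ?M * (D\<^sup>2 / (1 - c\<^sup>2))"
    using M by (auto intro: mult_left_mono)
  then have "Gam \<alpha> t * (\<Sum>i=1..t. ?p i * ?d i) \<le> Gam \<alpha> t * (?M * (D\<^sup>2 / (1 - c\<^sup>2)))"
    using Gpos[of t] by (intro mult_left_mono) auto
  also have "\<dots> = 2 * theta \<alpha> c t * D\<^sup>2" using c2 by (simp add: theta_def field_simps)
  finally have sum_d: "Gam \<alpha> t * (\<Sum>i=1..t. ?p i * ?d i) \<le> 2 * theta \<alpha> c t * D\<^sup>2" .
  \<comment> \<open>Pass through \<open>ustar\<close> and \<open>r i\<close>: the first two legs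
    have length at most \<open>D\<close>, whence 3 (D^2 + D^2) = 6 D^2.\<close>
  have "(norm (r 1 - w (i + 1)))\<^sup>2 \<le> 6 * D\<^sup>2 + 3 * ?d i" if "i \<in> {1..t}" for i
  proof -
    have "(norm (r 1 - w (i + 1)))\<^sup>2
        \<le> 3 * ((norm (r 1 - ustar))\<^sup>2 + (norm (ustar - r i))\<^sup>2 + ?d i)"
      using norm_add3_squared_le[of "r 1 - ustar" "ustar - r i" "r i - w (i + 1)"] by simp
    moreover have "(norm (ustar - r i))\<^sup>2 \<le> D\<^sup>2"
      using r_us[of i] that by (intro power_mono) (auto simp: norm_minus_commute)
    ultimately show ?thesis unfolding D[symmetric] by argo
  qed
  then have "(\<Sum>i=1..t. ?p i * (norm (r 1 - w (i + 1)))\<^sup>2)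
      \<le> (\<Sum>i=1..t. ?p i * (6 * D\<^sup>2 + 3 * ?d i))"
    using p_nonneg by (intro sum_mono mult_left_mono) auto
  also have "\<dots> = 6 * D\<^sup>2 * (\<Sum>i=1..t. ?p i) + 3 * (\<Sum>i=1..t. ?p i * ?d i)"
    by (simp add: sum.distrib sum_distrib_left algebra_simps)
  finally have "Gam \<alpha> t * (\<Sum>i=1..t. ?p i * (norm (r 1 - w (i + 1)))\<^sup>2)
      \<le> Gam \<alpha> t * (6 * D\<^sup>2 * (\<Sum>i=1..t. ?p i) + 3 * (\<Sum>i=1..t. ?p i * ?d i))"
    using Gpos[of t] by (intro mult_left_mono) auto
  also have "\<dots> = 6 * D\<^sup>2 * (Gam \<alpha> t * (\<Sum>i=1..t. ?p i))
      + 3 * (Gam \<alpha> t * (\<Sum>i=1..t. ?p i * ?d i))"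
    by (simp only: distrib_left mult.left_commute)
  also have "\<dots> \<le> 6 * D\<^sup>2 + 3 * (2 * theta \<alpha> c t * D\<^sup>2)"
    using sum_d Gam_weights_sum_one[of \<alpha> t] alpha_1 \<alpha>_lt t by simp
  finally have dist: "(norm (r 1 - ?x))\<^sup>2 \<le> 6 * (1 + theta \<alpha> c t) * D\<^sup>2"
    using averaged_sequence_norm_le[of \<alpha> w_ag w t "r 1"] alpha_1 alpha ag t
    by (simp add: algebra_simps)

  \<comment> \<open>The perturbation vector and its error\<close>
  let ?A = "\<alpha> t / \<gamma> t"
  have A: "?A \<ge> 0" using \<alpha>01[OF t] gamma_pos[OF t] by simp
  define v where "v = ?A *\<^sub>R (r 1 - r (t + 1))"
  define \<epsilon> where "\<epsilon> = ?A / 2 * (norm (r 1 - ?x))\<^sup>2"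
  have "Q_gap G H J ?x u - v \<bullet> (?x - u) \<le> \<epsilon>" if u: "u \<in> Z" for u
  proof -
    \<comment> \<open>Adding the square of the distance from \<open>r (t + 1)\<close> to
      \<open>?x\<close> only weakens the bound and leaves an expression affine in \<open>u\<close>.
      Subtracting the term of \<open>v\<close> removes \<open>u\<close> altogether, so the supremum
      is finite even for unbounded \<open>Z\<close>.\<close>
    have "0 \<le> (1 - c\<^sup>2) * S t" using c2 S_nonneg by simp
    then have "(norm (r 1 - u))\<^sup>2 - (norm (r (t + 1) - u))\<^sup>2 - (1 - c\<^sup>2) * S t
        \<le> (norm (r 1 - u))\<^sup>2 - (norm (r (t + 1) - u))\<^sup>2 + (norm (r (t + 1) - ?x))\<^sup>2"
      using zero_le_power2[of "norm (r (t + 1) - ?x)"] by linarith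
    also have "\<dots> = (norm (r 1 - ?x))\<^sup>2 + 2 * ((r 1 - r (t + 1)) \<bullet> (?x - u))"
      unfolding power2_norm_eq_inner
      by (simp add: inner_diff_left inner_diff_right inner_commute)
    finally have "?A / 2 * ((norm (r 1 - u))\<^sup>2 - (norm (r (t + 1) - u))\<^sup>2 - (1 - c\<^sup>2) * S t)
        \<le> ?A / 2 * ((norm (r 1 - ?x))\<^sup>2 + 2 * ((r 1 - r (t + 1)) \<bullet> (?x - u)))"
      using A by (intro mult_left_mono) auto
    moreover have "v \<bullet> (?x - u) = ?A * ((r 1 - r (t + 1)) \<bullet> (?x - u))"
      unfolding v_def by (rule inner_scaleR_left)
    ultimately show ?thesis
      using tele[OF t u] unfolding ratio_k[OF t, symmetric] \<epsilon>_def by (simp add: algebra_simps)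
  qed
  then have "perturbed_gap Z G H J ?x v \<le> ereal \<epsilon>"
    unfolding perturbed_gap_def by (intro SUP_least) simp
  moreover have "\<epsilon> \<ge> 0" unfolding \<epsilon>_def using A by (intro mult_nonneg_nonneg) auto
  moreover have "norm v \<le> 2 * \<alpha> t * D / \<gamma> t"
  proof -
    have "norm (r 1 - r (t + 1)) \<le> norm (r 1 - ustar) + norm (r (t + 1) - ustar)"
      using norm_triangle_ineq4[of "r 1 - ustar" "r (t + 1) - ustar"] by simp
    then have "norm (r 1 - r (t + 1)) \<le> 2 * D" using r_us[of 1] r_us[of "t + 1"] by simp
    then have "?A * norm (r 1 - r (t + 1)) \<le> ?A * (2 * D)" using A by (rule mult_left_mono)
    moreover have "norm v = ?A * norm (r 1 - r (t + 1))"
      unfolding v_def norm_scaleR abs_of_nonneg[OF A] ..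
    ultimately show ?thesis by (simp add: mult.commute mult.left_commute)
  qed
  moreover have "\<epsilon> \<le> 3 * \<alpha> t * (1 + theta \<alpha> c t) * D\<^sup>2 / \<gamma> t"
  proof -
    have "\<epsilon> \<le> ?A / 2 * (6 * (1 + theta \<alpha> c t) * D\<^sup>2)"
      unfolding \<epsilon>_def using dist A by (intro mult_left_mono) auto
    also have "\<dots> = 3 * \<alpha> t * (1 + theta \<alpha> c t) * D\<^sup>2 / \<gamma> t"
      using gamma_pos[OF t] by (simp add: field_simps)
    finally show ?thesis .
  qed
  ultimately show "\<exists>v \<epsilon>. \<epsilon> \<ge> 0 \<and>
           perturbed_gap Z G H J (w_ag (t + 1)) v \<le> ereal \<epsilon> \<and>
           norm v \<le> 2 * \<alpha> t * D / \<gamma> t \<and>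
           \<epsilon> \<le> 3 * \<alpha> t * (1 + theta \<alpha> c t) * D\<^sup>2 / \<gamma> t"
    by blast
qed

end
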